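(* Let $K$ and $L$ be finite abstract simplicial complexes and let $\varphi,\psi\colon K\to L$ be simplicial maps in the same contiguity class. Then the induced simplicial maps $\mathrm{sd}\,\varphi,\mathrm{sd}\,\psi\colon \mathrm{sd}\,K\to\mathrm{sd}\,L$ are in the same contiguity class.
   Context: Two simplicial maps $\varphi,\psi\colon K\to L$ between abstract simplicial complexes are contiguous, $\varphi\sim_c\psi$, if for every simplex $\sigma$ of $K$ the set of vertices $\varphi(\sigma)\cup\psi(\sigma)$ is a simplex of $L$. They are in the same contiguity class, $\varphi\sim\psi$, if there is a finite sequence of simplicial maps $\varphi=\varphi_1\sim_c\varphi_2\sim_c\cdots\sim_c\varphi_m=\psi$ from $K$ to $L$. The first barycentric subdivision $\mathrm{sd}\,K$ is the abstract simplicial complex whose vertices are the (nonempty) simplices of $K$, and whose simplices are the sets $\{\sigma_1,\dots,\sigma_q\}$ of simplices of $K$ with $\sigma_1\subset\cdots\subset\sigma_q$. For a simplicial map $\varphi\colon K\to L$, the induced simplicial map $\mathrm{sd}\,\varphi\colon\mathrm{sd}\,K\to\mathrm{sd}\,L$ is defined by $(\mathrm{sd}\,\varphi)(\{\sigma_1,\dots,\sigma_q\})=\{\varphi(\sigma_1),\dots,\varphi(\sigma_q)\}$. *)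

theory Defs
  imports Main
begin

text \<open>An abstract simplicial complex is represented by its set of simplices. Simplices are
  nonempty, and the vertex set of \<open>K\<close> is \<open>\<Union>K\<close>.\<close>

definition abstract_complex :: "'a set set \<Rightarrow> bool" where
  "abstract_complex K \<longleftrightarrow>
     (\<forall>\<sigma>\<in>K. finite \<sigma> \<and> \<sigma> \<noteq> {}) \<and> (\<forall>\<sigma>\<in>K. \<forall>\<tau>. \<tau> \<subseteq> \<sigma> \<and> \<tau> \<noteq> {} \<longrightarrow> \<tau> \<in> K)"

text \<open>Simplicial maps are vertex maps; their values outside \<open>\<Union>K\<close> are irrelevant.
  Maps that agree on \<open>\<Union>K\<close> are contiguous, so these values do not affect contiguity classes.\<close>

definition simplicial_map :: "'a set set \<Rightarrow> 'b set set \<Rightarrow> ('a \<Rightarrow> 'b) \<Rightarrow> bool" where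
  "simplicial_map K L \<phi> \<longleftrightarrow> (\<forall>\<sigma>\<in>K. \<phi> ` \<sigma> \<in> L)"

definition contiguous :: "'a set set \<Rightarrow> 'b set set \<Rightarrow> ('a \<Rightarrow> 'b) \<Rightarrow> ('a \<Rightarrow> 'b) \<Rightarrow> bool" where
  "contiguous K L \<phi> \<psi> \<longleftrightarrow>
     simplicial_map K L \<phi> \<and> simplicial_map K L \<psi> \<and> (\<forall>\<sigma>\<in>K. \<phi> ` \<sigma> \<union> \<psi> ` \<sigma> \<in> L)"

definition same_contiguity_class ::
    "'a set set \<Rightarrow> 'b set set \<Rightarrow> ('a \<Rightarrow> 'b) \<Rightarrow> ('a \<Rightarrow> 'b) \<Rightarrow> bool" where
  "same_contiguity_class K L \<phi> \<psi> \<longleftrightarrow>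
     (\<exists>(m::nat) \<Phi>. 1 \<le> m \<and> \<Phi> 1 = \<phi> \<and> \<Phi> m = \<psi> \<and>
        (\<forall>i\<in>{1..m}. simplicial_map K L (\<Phi> i)) \<and>
        (\<forall>i\<in>{1..<m}. contiguous K L (\<Phi> i) (\<Phi> (Suc i))))"

definition sd :: "'a set set \<Rightarrow> 'a set set set" where
  "sd K = {C. finite C \<and> C \<noteq> {} \<and> subset.chain K C}"

text \<open>On vertices of \<open>sd K\<close>, i.e. simplices of \<open>K\<close>. The value on a simplex \<open>C\<close> of \<open>sd K\<close>
  is the image \<open>sd_map \<phi> ` C\<close>.\<close>

definition sd_map :: "('a \<Rightarrow> 'b) \<Rightarrow> 'a set \<Rightarrow> 'b set" where
  "sd_map \<phi> \<sigma> = \<phi> ` \<sigma>"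

lemma abstract_complex_sd: "abstract_complex (sd K)"
  unfolding abstract_complex_def sd_def subset_chain_def
  by (auto intro: finite_subset)

lemma vertices_sd: "\<Union>(sd K) = K"
proof
  show "\<Union>(sd K) \<subseteq> K"
    by (auto simp: sd_def subset_chain_def)
  show "K \<subseteq> \<Union>(sd K)"
  proof
    fix \<sigma> assume "\<sigma> \<in> K"
    then have "{\<sigma>} \<in> sd K" by (simp add: sd_def subset_chain_def)
    then show "\<sigma> \<in> \<Union>(sd K)" by blast
  qed
qed

lemma simplicial_map_sd_map:
  assumes "simplicial_map K L \<phi>"
  shows "simplicial_map (sd K) (sd L) (sd_map \<phi>)"
  unfolding simplicial_map_def
proof
  fix C assume "C \<in> sd K"
  then have C: "finite C" "C \<noteq> {}" "C \<subseteq> K" "\<And>x y. x \<in> C \<Longrightarrow> y \<in> C \<Longrightarrow> x \<subseteq> y \<or> y \<subseteq> x"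
    by (auto simp: sd_def subset_chain_def)
  have "sd_map \<phi> ` C \<subseteq> L"
    using assms C(3) by (auto simp: simplicial_map_def sd_map_def)
  moreover have "x \<subseteq> y \<or> y \<subseteq> x" if "x \<in> sd_map \<phi> ` C" "y \<in> sd_map \<phi> ` C" for x y
  proof -
    from that obtain a b where "a \<in> C" "b \<in> C" "x = \<phi> ` a" "y = \<phi> ` b"
      by (auto simp: sd_map_def)
    then show ?thesis using C(4)[of a b] by (metis image_mono)
  qed
  ultimately show "sd_map \<phi> ` C \<in> sd L"
    using C(1,2) by (simp add: sd_def subset_chain_def)
qed

lemma contiguous_if_agree_on_vertices:
  assumes "simplicial_map K L \<phi>" "\<And>v. v \<in> \<Union>K \<Longrightarrow> \<psi> v = \<phi> v"
  shows "contiguous K L \<phi> \<psi>"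
proof -
  have "\<psi> ` \<sigma> = \<phi> ` \<sigma>" if "\<sigma> \<in> K" for \<sigma>
    using that assms(2) by (intro image_cong) auto
  then show ?thesis using assms(1) by (simp add: contiguous_def simplicial_map_def)
qed

end

theory Submission
  imports Defs
begin

text \<open>For a single contiguity, both \<open>sd \<phi>\<close> and \<open>sd \<psi>\<close> lie pointwise below the order-preserving map
  \<open>\<sigma> \<mapsto> \<phi>(\<sigma>) \<union> \<psi>(\<sigma>)\<close> of face posets, so it suffices to connect order-preserving maps \<open>f \<le> g\<close>.
  Replacing \<open>f\<close> by \<open>g\<close> one simplex at a time, from the largest simplices down, keeps the map order-preserving,
  and two successive maps are contiguous: on a chain through the altered simplex \<open>p\<close>
  their values together form \<open>\<dots> \<subseteq> f(p) \<subseteq> g(p) \<subseteq> \<dots>\<close>.\<close>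

text \<open>A monotone map carries chains to chains. This admits vertex maps on \<open>sd K\<close>
  that no vertex map of \<open>K\<close> induces, such as the intermediate maps below.\<close>

lemma simplicial_map_sd_mono_on:
  assumes "mono_on K f" "f ` K \<subseteq> L"
  shows "simplicial_map (sd K) (sd L) f"
  unfolding simplicial_map_def
proof
  fix C assume "C \<in> sd K"
  then have C: "finite C" "C \<noteq> {}" "C \<subseteq> K" "\<And>x y. x \<in> C \<Longrightarrow> y \<in> C \<Longrightarrow> x \<subseteq> y \<or> y \<subseteq> x"
    by (auto simp: sd_def subset_chain_def)
  have "f x \<subseteq> f y \<or> f y \<subseteq> f x" if "x \<in> C" "y \<in> C" for x y
    using C(3) C(4)[OF that] that mono_onD[OF assms(1), of x y] mono_onD[OF assms(1), of y x]
    by blast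
  moreover have "f ` C \<subseteq> L" using C(3) assms(2) by blast
  ultimately show "f ` C \<in> sd L"
    using C(1,2) by (auto simp: sd_def subset_chain_def)
qed

lemma contiguous_sym: "contiguous K L \<phi> \<psi> \<Longrightarrow> contiguous K L \<psi> \<phi>"
  by (simp add: contiguous_def Un_commute)

text \<open>Turns indexed sequences into paths, which concatenate and reverse easily. The conjunct
  on \<open>\<phi>\<close> covers the empty path, which exists for any map, whereas a sequence of
  length one must consist of a simplicial map.\<close>

lemma same_contiguity_class_iff_rtranclp:
  "same_contiguity_class K L \<phi> \<psi> \<longleftrightarrow> simplicial_map K L \<phi> \<and> (contiguous K L)\<^sup>*\<^sup>* \<phi> \<psi>"
proof
  assume "same_contiguity_class K L \<phi> \<psi>"
  then obtain m :: nat and \<Phi> where m: "1 \<le> m" "\<Phi> 1 = \<phi>" "\<Phi> m = \<psi>"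
      "\<forall>i\<in>{1..m}. simplicial_map K L (\<Phi> i)"
      "\<forall>i\<in>{1..<m}. contiguous K L (\<Phi> i) (\<Phi> (Suc i))"
    unfolding same_contiguity_class_def by blast
  have "(contiguous K L)\<^sup>*\<^sup>* (\<Phi> 1) (\<Phi> j)" if "1 \<le> j" "j \<le> m" for j
    using that
  proof (induction j rule: dec_induct)
    case (step n)
    with m(5) have "contiguous K L (\<Phi> n) (\<Phi> (Suc n))" by simp
    with step show ?case by (simp add: rtranclp.rtrancl_into_rtrancl)
  qed simp
  with m show "simplicial_map K L \<phi> \<and> (contiguous K L)\<^sup>*\<^sup>* \<phi> \<psi>"
    by force
next
  assume "simplicial_map K L \<phi> \<and> (contiguous K L)\<^sup>*\<^sup>* \<phi> \<psi>"
  then have "(contiguous K L)\<^sup>*\<^sup>* \<phi> \<psi>" "simplicial_map K L \<phi>" by auto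
  then show "same_contiguity_class K L \<phi> \<psi>"
  proof (induction rule: rtranclp_induct)
    case base
    then show ?case
      unfolding same_contiguity_class_def by (intro exI[of _ "1::nat"] exI[of _ "\<lambda>_. \<phi>"]) simp
  next
    case (step \<chi> \<psi>)
    then obtain m :: nat and \<Phi> where m: "1 \<le> m" "\<Phi> 1 = \<phi>" "\<Phi> m = \<chi>"
        "\<forall>i\<in>{1..m}. simplicial_map K L (\<Phi> i)"
        "\<forall>i\<in>{1..<m}. contiguous K L (\<Phi> i) (\<Phi> (Suc i))"
      unfolding same_contiguity_class_def by blast
    have "simplicial_map K L \<psi>" using step(2) by (simp add: contiguous_def)
    with m step(2) show ?case
      unfolding same_contiguity_class_def
      by (intro exI[of _ "Suc m"] exI[of _ "\<Phi>(Suc m := \<psi>)"])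
        (auto simp: le_Suc_eq less_Suc_eq)
  qed
qed

text \<open>Along a chain a \<subset> b \<subset> ... the values interleave as f a \<subseteq> g a
  \<subseteq> f b \<subseteq> g b \<subseteq> ..., so together they again form a chain.\<close>

lemma contiguous_sd_interleaved:
  assumes f: "mono_on K f" "f ` K \<subseteq> L" and g: "mono_on K g" "g ` K \<subseteq> L"
    and le: "\<And>\<sigma>. \<sigma> \<in> K \<Longrightarrow> f \<sigma> \<subseteq> g \<sigma>"
    and less: "\<And>\<sigma> \<tau>. \<sigma> \<in> K \<Longrightarrow> \<tau> \<in> K \<Longrightarrow> \<sigma> \<subset> \<tau> \<Longrightarrow> g \<sigma> \<subseteq> f \<tau>"
  shows "contiguous (sd K) (sd L) f g"
  unfolding contiguous_def
proof (intro conjI ballI)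
  fix C assume "C \<in> sd K"
  then have C: "finite C" "C \<noteq> {}" "C \<subseteq> K" "\<And>x y. x \<in> C \<Longrightarrow> y \<in> C \<Longrightarrow> x \<subseteq> y \<or> y \<subseteq> x"
    by (auto simp: sd_def subset_chain_def)
  have comparable: "u \<subseteq> v \<or> v \<subseteq> u"
    if x: "x \<in> C" "u \<in> {f x, g x}" and y: "y \<in> C" "v \<in> {f y, g y}" for x y u v
  proof -
    have xy: "x \<in> K" "y \<in> K" using x y C(3) by auto
    consider "x = y" | "x \<subset> y" | "y \<subset> x" using C(4)[OF x(1) y(1)] by blast
    then show ?thesis
    proof cases
      case 1
      then show ?thesis using x y le[OF xy(1)] by auto
    next
      case 2
      then show ?thesis using x y le[OF xy(1)] le[OF xy(2)] less[OF xy 2] by blast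
    next
      case 3
      then show ?thesis using x y le[OF xy(1)] le[OF xy(2)] less[OF xy(2,1) 3] by blast
    qed
  qed
  have "\<forall>u\<in>f ` C \<union> g ` C. \<forall>v\<in>f ` C \<union> g ` C. u \<subseteq> v \<or> v \<subseteq> u"
    using comparable by blast
  moreover have "f ` C \<union> g ` C \<subseteq> L" using f(2) g(2) C(3) by blast
  ultimately show "f ` C \<union> g ` C \<in> sd L"
    using C(1,2) by (simp add: sd_def subset_chain_def)
qed (simp_all add: simplicial_map_sd_mono_on f g)

lemma rtranclp_contiguous_sd_upset:
  assumes "finite U" "U \<subseteq> K"
    and up: "\<And>\<sigma> \<tau>. \<sigma> \<in> U \<Longrightarrow> \<tau> \<in> K \<Longrightarrow> \<sigma> \<subseteq> \<tau> \<Longrightarrow> \<tau> \<in> U"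
    and f: "mono_on K f" "f ` K \<subseteq> L" and g: "mono_on K g" "g ` K \<subseteq> L"
    and le: "\<And>\<sigma>. \<sigma> \<in> K \<Longrightarrow> f \<sigma> \<subseteq> g \<sigma>"
  shows "(contiguous (sd K) (sd L))\<^sup>*\<^sup>* f (\<lambda>\<sigma>. if \<sigma> \<in> U then g \<sigma> else f \<sigma>)"
  using assms(1-3)
proof (induction U rule: finite_psubset_induct)
  case (psubset U)
  show ?case
  proof (cases "U = {}")
    case False
    \<comment> \<open>Removing a minimal \<open>p\<close> keeps \<open>U\<close> upward closed, so
      the induction hypothesis applies to \<open>U - {p}\<close> and \<open>p\<close> is the last
      simplex to be switched.\<close>
    then obtain p where p: "p \<in> U" "\<And>\<sigma>. \<sigma> \<in> U \<Longrightarrow> \<sigma> \<subseteq> p \<Longrightarrow> \<sigma> = p"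
      using finite_has_minimal[OF psubset.hyps] by metis
    define h where "h V \<sigma> = (if \<sigma> \<in> V then g \<sigma> else f \<sigma>)" for V \<sigma>
    have mono: "mono_on K (h V)"
      if "\<And>\<sigma> \<tau>. \<sigma> \<in> V \<Longrightarrow> \<tau> \<in> K \<Longrightarrow> \<sigma> \<subseteq> \<tau> \<Longrightarrow> \<tau> \<in> V" for V
    proof (rule mono_onI)
      \<comment> \<open>Upward closure excludes a step from \<open>g\<close> back down to
        \<open>f\<close>. The one mixed case is f \<sigma> \<subseteq> f \<tau> \<subseteq> g
        \<tau>.\<close>
      fix \<sigma> \<tau> assume st: "\<sigma> \<in> K" "\<tau> \<in> K" "\<sigma> \<subseteq> \<tau>"
      then show "h V \<sigma> \<subseteq> h V \<tau>"
        using that[of \<sigma> \<tau>] mono_onD[OF f(1) st] mono_onD[OF g(1) st] le[of \<tau>]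
        by (auto simp: h_def)
    qed
    have img: "h V ` K \<subseteq> L" for V using f(2) g(2) by (auto simp: h_def)
    have up': "\<tau> \<in> U - {p}" if "\<sigma> \<in> U - {p}" "\<tau> \<in> K" "\<sigma> \<subseteq> \<tau>" for \<sigma> \<tau>
      using that p psubset.prems(2)[of \<sigma> \<tau>] by blast
    have "(contiguous (sd K) (sd L))\<^sup>*\<^sup>* f (h (U - {p}))"
      unfolding h_def
    proof (rule psubset.IH)
      show "U - {p} \<subset> U" using p(1) by blast
      show "U - {p} \<subseteq> K" using psubset.prems(1) by blast
    qed (rule up')
    moreover have "contiguous (sd K) (sd L) (h (U - {p})) (h U)"
    proof (rule contiguous_sd_interleaved)
      show mono_U: "mono_on K (h U)" using psubset.prems(2) by (rule mono)
      show mono_p: "mono_on K (h (U - {p}))" using up' by (rule mono)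
      show "h (U - {p}) \<sigma> \<subseteq> h U \<sigma>" if "\<sigma> \<in> K" for \<sigma>
        using le[OF that] by (auto simp: h_def)
      fix \<sigma> \<tau> assume st: "\<sigma> \<in> K" "\<tau> \<in> K" "\<sigma> \<subset> \<tau>"
      \<comment> \<open>The two maps differ at most at \<open>p\<close>. If \<sigma> lies in
        \<open>U\<close>, minimality gives \<tau> \<noteq> p; otherwise \<sigma> \<noteq> p. Either
        way the inclusion reduces to monotonicity of a single one of them.\<close>
      have "h U \<tau> = h (U - {p}) \<tau>" if "\<sigma> \<in> U"
        using that p st by (auto simp: h_def)
      moreover have "h U \<sigma> = h (U - {p}) \<sigma>" if "\<sigma> \<notin> U"
        using that by (simp add: h_def)
      ultimately show "h U \<sigma> \<subseteq> h (U - {p}) \<tau>"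
        using mono_onD[OF mono_U st(1,2)] mono_onD[OF mono_p st(1,2)] st(3)
        by (cases "\<sigma> \<in> U") auto
    qed (fact img)+
    ultimately have "(contiguous (sd K) (sd L))\<^sup>*\<^sup>* f (h U)"
      by (meson rtranclp.rtrancl_into_rtrancl)
    then show ?thesis by (simp add: h_def[abs_def])
  qed simp
qed

lemma rtranclp_contiguous_sd_le:
  assumes "finite K"
    and f: "mono_on K f" "f ` K \<subseteq> L" and g: "mono_on K g" "g ` K \<subseteq> L"
    and le: "\<And>\<sigma>. \<sigma> \<in> K \<Longrightarrow> f \<sigma> \<subseteq> g \<sigma>"
  shows "(contiguous (sd K) (sd L))\<^sup>*\<^sup>* f g"
proof -
  \<comment> \<open>This is the case \<open>U = K\<close>. Off \<open>K\<close> the map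
    \<open>?h\<close> still equals \<open>f\<close>, so one further contiguity, between maps
    agreeing on the vertices of \<open>sd K\<close>, is needed to reach \<open>g\<close>.\<close>
  let ?h = "\<lambda>\<sigma>. if \<sigma> \<in> K then g \<sigma> else f \<sigma>"
  have "(contiguous (sd K) (sd L))\<^sup>*\<^sup>* f ?h"
    using assms by (intro rtranclp_contiguous_sd_upset) auto
  moreover have "contiguous (sd K) (sd L) g ?h"
    by (rule contiguous_if_agree_on_vertices)
      (simp_all add: vertices_sd simplicial_map_sd_mono_on g)
  ultimately show ?thesis
    by (meson contiguous_sym rtranclp.rtrancl_into_rtrancl)
qed

lemma rtranclp_contiguous_sd_map:
  assumes "finite K" "contiguous K L \<phi> \<psi>"
  shows "(contiguous (sd K) (sd L))\<^sup>*\<^sup>* (sd_map \<phi>) (sd_map \<psi>)"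
proof -
  \<comment> \<open>Contiguity of \<phi> and \<psi> is what makes \<open>?u\<close> take values in
    \<open>L\<close> on \<open>K\<close>.\<close>
  let ?u = "\<lambda>\<sigma>. \<phi> ` \<sigma> \<union> \<psi> ` \<sigma>"
  have below: "(contiguous (sd K) (sd L))\<^sup>*\<^sup>* (sd_map \<chi>) ?u" if "\<chi> = \<phi> \<or> \<chi> = \<psi>" for \<chi>
    using assms that
    by (intro rtranclp_contiguous_sd_le)
      (auto simp: contiguous_def simplicial_map_def sd_map_def intro!: mono_onI imageI)
  \<comment> \<open>Symmetry reverses the path from \<open>sd_map \<psi>\<close> up to
    \<open>?u\<close>, so the two paths join at \<open>?u\<close>.\<close>
  have "symp (contiguous (sd K) (sd L))"
    by (simp add: contiguous_sym sympI)
  then have "(contiguous (sd K) (sd L))\<^sup>*\<^sup>* ?u (sd_map \<psi>)"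
    using below[of \<psi>] by (blast dest: symp_rtranclp sympD)
  with below[of \<phi>] show ?thesis by simp
qed

theorem proposition3p1p3:
  fixes K :: "'a set set" and L :: "'b set set" and \<phi> \<psi> :: "'a \<Rightarrow> 'b"
  assumes "abstract_complex K" and "finite K"
    and "abstract_complex L" and "finite L"
    and "simplicial_map K L \<phi>" and "simplicial_map K L \<psi>"
    and "same_contiguity_class K L \<phi> \<psi>"
  shows "same_contiguity_class (sd K) (sd L) (sd_map \<phi>) (sd_map \<psi>)"
proof -
  have "(contiguous K L)\<^sup>*\<^sup>* \<phi> \<psi>"
    using assms(7) by (simp add: same_contiguity_class_iff_rtranclp)
  then have "(contiguous (sd K) (sd L))\<^sup>*\<^sup>* (sd_map \<phi>) (sd_map \<psi>)"
  \<comment> \<open>Each link between \<phi> and \<psi> becomes a whole path between the subdivided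
    maps, and these paths are concatenated.\<close>
  proof (induction rule: rtranclp_induct)
    case (step \<chi> \<psi>)
    show ?case
      using step(3) rtranclp_contiguous_sd_map[OF assms(2) step(2)] by (rule rtranclp_trans)
  qed simp
  then show ?thesis
    using assms(5) by (simp add: same_contiguity_class_iff_rtranclp simplicial_map_sd_map)
qed

end
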